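(* Suppose $f$ and $\Psi$ are convex. Let $c=\max\{\bar\theta,\eta(L_{\max}+\sigma)\}$ with $L_{\max}=\max_iL_i$, let $p_{\min}=\min_ip_i$, and let $$r=\max_x\{\mathrm{dist}(x,X^* ):x\in\Omega(x^0)\},\qquad q=\max_x\{\|\nabla f(x)\|:x\in\Omega(x^0)\},$$ where $\Omega(x^0)=\{x\in\mathbb{R}^N:F(x)\le F(x^0)\}$ and $X^*$ is the set of optimal solutions of $\min_xF(x)$. Assume that $r$ and $q$ are finite. Suppose that $\Psi$ is $L_\Psi$-Lipschitz continuous in $\mathrm{dom}(\Psi)$, namely $$|\Psi(x)-\Psi(y)|\le L_\Psi\|x-y\|\qquad\forall x,y\in\mathrm{dom}(\Psi)$$ for some $L_\Psi>0$. Let $\{x^k\}$ be generated by the RNBPG method with $M=0$. Then $$\mathbf{E}_{\xi_{k-1}}[F(x^k)]-F^*\le\frac{\max\{2/\alpha,\ F(x^0)-F^*\}}{k+1}\qquad\forall k\ge0,$$ where $F^*$ is the optimal value and $$\alpha=\frac{\sigma p_{\min}^2}{2(L_\Psi+q+cr)^2}.$$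
   Context: **Problem.** $x\in\mathbb{R}^N$ is partitioned into blocks $x=(x_1,\dots,x_n)$, $x_i\in\mathbb{R}^{N_i}$. Consider $\min_{x\in\mathbb{R}^N}\{F(x):=f(x)+\Psi(x)\}$ with $\Psi(x)=\sum_{i=1}^n\Psi_i(x_i)$. The function $f:\mathbb{R}^N\to\mathbb{R}$ is differentiable, and $\Psi_i:\mathbb{R}^{N_i}\to\mathbb{R}\cup\{+\infty\}$. $\|\cdot\|$ is the Euclidean norm, $\nabla_i f$ is the partial gradient with respect to $x_i$, and there are constants $L_i>0$ with $\|\nabla_i f(x+h)-\nabla_i f(x)\|\le L_i\|h\|$ for all $x\in\mathbb{R}^N$, all $i$, and all $h=(h_1,\dots,h_n)$ with $h_j=0$ for all $j\ne i$. The set $X^*$ of optimal solutions is nonempty, with optimal value $F^*$; $\mathrm{dom}$ of a function is the set where it is $<+\infty$; $\mathrm{dist}(x,S)$ is the Euclidean distance from $x$ to $S$. **RNBPG method with $M=0$.** Choose $x^0\in\mathrm{dom}(F)$, $\eta>1$, $\sigma>0$, $0<\underline\theta\le\bar\theta$, and $0<p_i<1$ with $\sum_{i=1}^n p_i=1$. For $k=0,1,2,\dots$: 1) Set $d^k=0$. Pick $i_k=i\in\{1,\dots,n\}$ with probability $p_i$. Choose $\theta_k^0\in[\underline\theta,\bar\theta]$. 2) For $j=0,1,\dots$: let $\theta_k=\theta_k^0\eta^j$, compute the $i_k$-th block of $d^k$ (the other blocks being $0$) as $(d^k)_{i_k}=\arg\min_s\{\nabla_{i_k}f(x^k)^Ts+\frac{\theta_k}{2}\|s\|^2+\Psi_{i_k}(x^k_{i_k}+s)\}$;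 if $F(x^k+d^k)\le F(x^k)-\frac{\sigma}{2}\|d^k\|^2$, stop the inner loop. 3) Set $x^{k+1}=x^k+d^k$. $\arg\min$ denotes a minimizer (assumed to exist). **Randomness.** The $i_k$ are drawn independently; $\xi_k=\{i_0,\dots,i_k\}$, and $\mathbf{E}_{\xi_k}$ is expectation with respect to $\xi_k$ ($\mathbf{E}_{\xi_{-1}}[F(x^0)]=F(x^0)$). All other choices (such as $\theta^0_k$) are determined by the realized indices, so $x^k$ is a function of $\xi_{k-1}$ and $d^k$ is a function of $\xi_k$. *)

theory Defs
  imports "HOL-Probability.Probability"
begin

text \<open>
  A partition of the coordinates of \<open>real ^ 'n\<close> into nonempty blocks indexed by \<open>'i\<close> is a
  surjection \<open>\<beta> :: 'n \<Rightarrow> 'i\<close>. The block space with index \<open>i\<close> is identified isometrically with the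
  subspace of vectors vanishing outside block \<open>i\<close>; the component \<open>x\<^sub>i\<close> is \<open>block \<beta> i x\<close>.
\<close>

definition block_space :: "('n \<Rightarrow> 'i) \<Rightarrow> 'i \<Rightarrow> (real ^ 'n) set" where
  "block_space \<beta> i = {s. \<forall>j. \<beta> j \<noteq> i \<longrightarrow> s $ j = 0}"

definition block :: "('n \<Rightarrow> 'i) \<Rightarrow> 'i \<Rightarrow> real ^ 'n \<Rightarrow> real ^ 'n" where
  "block \<beta> i x = (\<chi> j. if \<beta> j = i then x $ j else 0)"

text \<open>
  \<open>\<psi> i\<close> is only ever evaluated on \<open>block_space \<beta> i\<close>; its values elsewhere are irrelevant.
\<close>

definition block_sum ::
    "('n \<Rightarrow> 'i) \<Rightarrow> ('i::finite \<Rightarrow> real ^ 'n \<Rightarrow> ereal) \<Rightarrow> real ^ 'n \<Rightarrow> ereal" where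
  "block_sum \<beta> \<psi> x = (\<Sum>i\<in>UNIV. \<psi> i (block \<beta> i x))"

definition objective ::
    "('n \<Rightarrow> 'i) \<Rightarrow> (real ^ 'n \<Rightarrow> real) \<Rightarrow> ('i::finite \<Rightarrow> real ^ 'n \<Rightarrow> ereal) \<Rightarrow> real ^ 'n \<Rightarrow> ereal" where
  "objective \<beta> f \<psi> x = ereal (f x) + block_sum \<beta> \<psi> x"

definition ereal_dom :: "('a \<Rightarrow> ereal) \<Rightarrow> 'a set" where
  "ereal_dom g = {x. g x < \<infinity>}"

text \<open>The endpoints \<open>t = 0, 1\<close> are harmless because \<open>0 * \<infinity> = 0\<close> in \<open>ereal\<close>.\<close>

definition ereal_convex :: "('a::real_vector \<Rightarrow> ereal) \<Rightarrow> bool" where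
  "ereal_convex g \<longleftrightarrow> (\<forall>x y. \<forall>t\<in>{0..1}.
     g ((1 - t) *\<^sub>R x + t *\<^sub>R y) \<le> ereal (1 - t) * g x + ereal t * g y)"

definition optimal_set :: "('a \<Rightarrow> ereal) \<Rightarrow> 'a set" where
  "optimal_set F = {x. \<forall>y. F x \<le> F y}"

definition optimal_value :: "('a \<Rightarrow> ereal) \<Rightarrow> ereal" where
  "optimal_value F = (INF x. F x)"

definition level_set :: "('a \<Rightarrow> ereal) \<Rightarrow> 'a \<Rightarrow> 'a set" where
  "level_set F x0 = {x. F x \<le> F x0}"

text \<open>\<open>s\<close> is a minimizer of the block subproblem at \<open>x\<close>; \<open>g\<close> is the gradient of \<open>f\<close>.\<close>

definition is_trial_step ::
    "('n \<Rightarrow> 'i) \<Rightarrow> (real ^ 'n \<Rightarrow> real ^ 'n) \<Rightarrow> ('i \<Rightarrow> real ^ 'n \<Rightarrow> ereal) \<Rightarrow>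
     real \<Rightarrow> 'i \<Rightarrow> real ^ 'n \<Rightarrow> real ^ 'n \<Rightarrow> bool" where
  "is_trial_step \<beta> g \<psi> \<theta> i x s \<longleftrightarrow>
     is_arg_min
       (\<lambda>s. ereal (block \<beta> i (g x) \<bullet> s + \<theta> / 2 * (norm s)\<^sup>2) + \<psi> i (block \<beta> i x + s))
       (\<lambda>s. s \<in> block_space \<beta> i) s"

definition sufficient_decrease ::
    "('a::real_normed_vector \<Rightarrow> ereal) \<Rightarrow> real \<Rightarrow> 'a \<Rightarrow> 'a \<Rightarrow> bool" where
  "sufficient_decrease F \<sigma> x d \<longleftrightarrow> F (x + d) \<le> F x - ereal (\<sigma> / 2 * (norm d)\<^sup>2)"

text \<open>
  One outer iteration from \<open>x\<close> to \<open>x'\<close> with drawn block \<open>i\<close>: the inner loop computes the trial steps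
  \<open>s 0, \<dots>, s J\<close> and stops at the first one, \<open>s J\<close>, that gives sufficient decrease.
\<close>

definition rnbpg_step ::
    "('n \<Rightarrow> 'i::finite) \<Rightarrow> (real ^ 'n \<Rightarrow> real) \<Rightarrow> (real ^ 'n \<Rightarrow> real ^ 'n) \<Rightarrow>
     ('i \<Rightarrow> real ^ 'n \<Rightarrow> ereal) \<Rightarrow> real \<Rightarrow> real \<Rightarrow> real \<Rightarrow> real \<Rightarrow>
     'i \<Rightarrow> real ^ 'n \<Rightarrow> real ^ 'n \<Rightarrow> bool" where
  "rnbpg_step \<beta> f g \<psi> \<eta> \<sigma> \<theta>lo \<theta>hi i x x' \<longleftrightarrow>
     (\<exists>\<theta>0 \<in> {\<theta>lo..\<theta>hi}. \<exists>(s :: nat \<Rightarrow> real ^ 'n) J.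
        (\<forall>j\<le>J. is_trial_step \<beta> g \<psi> (\<theta>0 * \<eta> ^ j) i x (s j)) \<and>
        (\<forall>j<J. \<not> sufficient_decrease (objective \<beta> f \<psi>) \<sigma> x (s j)) \<and>
        sufficient_decrease (objective \<beta> f \<psi>) \<sigma> x (s J) \<and>
        x' = x + s J)"

text \<open>
  All choices other than the drawn indices are determined by these, so a run of the method is a map
  \<open>X\<close> from finite index histories (in chronological order) to iterates: \<open>X [i\<^sub>0, \<dots>, i\<^sub>k\<^sub>-\<^sub>1]\<close> is
  the iterate \<open>x\<^sup>k\<close> reached when these indices have been drawn.
\<close>

definition rnbpg_run ::
    "('n \<Rightarrow> 'i::finite) \<Rightarrow> (real ^ 'n \<Rightarrow> real) \<Rightarrow> (real ^ 'n \<Rightarrow> real ^ 'n) \<Rightarrow>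
     ('i \<Rightarrow> real ^ 'n \<Rightarrow> ereal) \<Rightarrow> real \<Rightarrow> real \<Rightarrow> real \<Rightarrow> real \<Rightarrow>
     real ^ 'n \<Rightarrow> ('i list \<Rightarrow> real ^ 'n) \<Rightarrow> bool" where
  "rnbpg_run \<beta> f g \<psi> \<eta> \<sigma> \<theta>lo \<theta>hi x0 X \<longleftrightarrow>
     X [] = x0 \<and>
     (\<forall>h i. rnbpg_step \<beta> f g \<psi> \<eta> \<sigma> \<theta>lo \<theta>hi i (X h) (X (h @ [i])))"

text \<open>
  The objective never increases along a run started in its domain, so it stays finite there and
  may be converted to a real number.
\<close>

lemma rnbpg_run_objective_le:
  fixes \<beta> :: "'n::finite \<Rightarrow> 'i::finite"
  assumes run: "rnbpg_run \<beta> f g \<psi> \<eta> \<sigma> \<theta>lo \<theta>hi x0 X" and "\<sigma> > 0"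
  shows "objective \<beta> f \<psi> (X h) \<le> objective \<beta> f \<psi> x0"
proof (induction h rule: rev_induct)
  case Nil
  then show ?case using run by (simp add: rnbpg_run_def)
next
  case (snoc i h)
  let ?F = "objective \<beta> f \<psi>"
  obtain d :: "real ^ 'n" where d: "?F (X (h @ [i])) \<le> ?F (X h) - ereal (\<sigma> / 2 * (norm d)\<^sup>2)"
  proof -
    have "rnbpg_step \<beta> f g \<psi> \<eta> \<sigma> \<theta>lo \<theta>hi i (X h) (X (h @ [i]))"
      using run by (simp add: rnbpg_run_def)
    then obtain s and J :: nat where "sufficient_decrease ?F \<sigma> (X h) (s J)" "X (h @ [i]) = X h + s J"
      unfolding rnbpg_step_def by blast
    then show thesis
      using that[of "s J"] by (simp only: sufficient_decrease_def)
  qed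
  have "?F (X h) - ereal (\<sigma> / 2 * (norm d)\<^sup>2) \<le> ?F (X h)"
    using \<open>\<sigma> > 0\<close> by (cases "?F (X h)") auto
  with d snoc.IH show ?case by (meson order_trans)
qed

end

theory Submission
  imports Defs
begin

text \<open>
  Fix an iterate \<open>x\<close> and imagine that all blocks are updated at once: \<open>d\<close> is the sum of the
  accepted steps \<open>s\<^sub>i\<close>, one for each possible draw \<open>i\<close>. Only one block is actually moved, but because
  blocks are orthogonal and \<open>\<Psi>\<close> is separable, \<open>d\<close> solves a single proximal problem over the whole
  space with block weights \<open>\<theta>\<^sub>i\<close>. Its optimality condition says that \<open>- (\<nabla>f(x) + u)\<close> is a
  subgradient of \<open>\<Psi>\<close> at \<open>x + d\<close>, where \<open>u = \<Sum>\<^sub>i \<theta>\<^sub>i s\<^sub>i\<close> (\<open>trial_steps_subgradient\<close>). The descent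
  lemma shows that a trial step with weight at least \<open>L\<^sub>i + \<sigma>\<close> is always accepted, so the inner loop
  never goes beyond \<open>\<theta>\<^sub>i \<le> c\<close> (\<open>rnbpg_step_accepted\<close>), and hence \<open>norm u \<le> c * norm d\<close>.

  Comparing \<open>x\<close> with a minimizer \<open>y\<close> through the gradient inequality for \<open>f\<close> and this subgradient
  inequality for \<open>\<Psi>\<close>, every term that survives carries a factor \<open>norm d\<close>: the change of \<open>\<Psi>\<close>
  from \<open>x\<close> to \<open>x + d\<close> contributes \<open>L\<Psi>\<close>, the gradient of \<open>f\<close> contributes \<open>q\<close>, and \<open>u\<close> contributes \<open>c\<close>
  times the distance from \<open>x\<close> to \<open>y\<close>. So the gap \<open>F(x) - F*\<close> is at most
  \<open>K * norm d\<close> with \<open>K = L\<Psi> + q + c * r\<close> (\<open>optimality_gap_le_step_norm\<close>).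

  The drawn block decreases the gap by \<open>\<sigma> / 2 * (norm s\<^sub>i)\<^sup>2\<close>, which is on average at least
  \<open>\<sigma> / 2 * p\<^sub>m\<^sub>i\<^sub>n * (norm d)\<^sup>2\<close>. Together with the gap bound, one iteration therefore lowers the gap \<open>e\<close>
  in conditional expectation by at least \<open>\<alpha> * e\<^sup>2\<close> (\<open>expected_gap_decrease\<close>). By Jensen's inequality
  the expected gaps \<open>E\<^sub>k\<close> obey \<open>E\<^sub>k\<^sub>+\<^sub>1 \<le> E\<^sub>k - \<alpha> * E\<^sub>k\<^sup>2\<close>, and this recurrence forces the \<open>O(1/k)\<close> rate
  (\<open>quadratic_decrease_rate\<close>). Since \<open>x\<^sup>k\<close> is a function of the finitely many index histories
  of length \<open>k\<close>, all expectations are finite sums.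
\<close>

section \<open>Block decomposition\<close>

lemma block_in_block_space [simp]: "block \<beta> i x \<in> block_space \<beta> i"
  by (simp add: block_def block_space_def)

lemma block_add: "block \<beta> i (x + y) = block \<beta> i x + block \<beta> i y"
  by (simp add: block_def vec_eq_iff)

lemma block_scaleR: "block \<beta> i (a *\<^sub>R x) = a *\<^sub>R block \<beta> i x"
  by (simp add: block_def vec_eq_iff)

lemma block_of_block_space:
  assumes "s \<in> block_space \<beta> i"
  shows "block \<beta> j s = (if j = i then s else 0)"
  using assms by (auto simp: block_def block_space_def vec_eq_iff)

lemma scaleR_in_block_space: "s \<in> block_space \<beta> i \<Longrightarrow> a *\<^sub>R s \<in> block_space \<beta> i"
  by (simp add: block_space_def)

lemma inner_block_space:
  assumes "s \<in> block_space \<beta> i"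
  shows "block \<beta> i a \<bullet> s = a \<bullet> s"
  using assms unfolding inner_vec_def
  by (intro sum.cong) (auto simp: block_def block_space_def)

lemma sum_block: "(\<Sum>i\<in>UNIV. block \<beta> (i::'i::finite) x) = x"
  by (simp add: vec_eq_iff block_def)

lemma sum_inner_block: "(\<Sum>i\<in>UNIV. block \<beta> (i::'i::finite) a \<bullet> block \<beta> i b) = a \<bullet> b"
proof -
  have "(\<Sum>i\<in>UNIV. block \<beta> i a \<bullet> block \<beta> i b) = (\<Sum>i\<in>UNIV. a \<bullet> block \<beta> i b)"
    by (intro sum.cong refl inner_block_space block_in_block_space)
  also have "\<dots> = a \<bullet> (\<Sum>i\<in>UNIV. block \<beta> i b)"
    by (rule inner_sum_right [symmetric])
  finally show ?thesis by (simp only: sum_block)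
qed

lemma sum_norm_block: "(\<Sum>i\<in>UNIV. (norm (block \<beta> (i::'i::finite) a))\<^sup>2) = (norm a)\<^sup>2"
  by (simp add: power2_norm_eq_inner sum_inner_block)

lemma block_sum_block_space:
  fixes D :: "'i::finite \<Rightarrow> real ^ 'n"
  assumes "\<And>i. D i \<in> block_space \<beta> i"
  shows "block \<beta> i (\<Sum>j\<in>UNIV. D j) = D i"
proof -
  have "block \<beta> i (\<Sum>j\<in>UNIV. D j) = (\<Sum>j\<in>UNIV. block \<beta> i (D j))"
    by (simp add: block_def vec_eq_iff)
  also have "\<dots> = D i"
    by (simp add: block_of_block_space [OF assms])
  finally show ?thesis .
qed

section \<open>Real analysis on lines, and the recurrence\<close>

lemma GDERIV_along_line:
  assumes "GDERIV f (x + t *\<^sub>R h) :> D"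
  shows "((\<lambda>t. f (x + t *\<^sub>R h)) has_real_derivative D \<bullet> h) (at t)"
proof -
  have "((\<lambda>t. x + t *\<^sub>R h) has_derivative (\<lambda>u. u *\<^sub>R h)) (at t)"
    by (auto intro!: derivative_eq_intros)
  from has_derivative_compose [OF this assms[unfolded gderiv_def]]
  show ?thesis
    unfolding has_field_derivative_def
    by (rule has_derivative_eq_rhs) (simp add: fun_eq_iff inner_commute [of h])
qed

lemma convex_on_gradient_inequality:
  fixes f :: "'a::real_inner \<Rightarrow> real"
  assumes "convex_on UNIV f" "GDERIV f x :> D"
  shows "f x + D \<bullet> (y - x) \<le> f y"
proof -
  let ?\<phi> = "\<lambda>t. f (x + t *\<^sub>R (y - x))"
  have "convex_on UNIV ?\<phi>"
  proof (rule convex_onI)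
    fix t a b :: real
    assume t: "0 < t" "t < 1"
    have "x + ((1 - t) * a + t * b) *\<^sub>R (y - x)
        = (1 - t) *\<^sub>R (x + a *\<^sub>R (y - x)) + t *\<^sub>R (x + b *\<^sub>R (y - x))"
      by (simp add: algebra_simps)
    then show "?\<phi> ((1 - t) *\<^sub>R a + t *\<^sub>R b) \<le> (1 - t) * ?\<phi> a + t * ?\<phi> b"
      using convex_onD [OF assms(1), of t "x + a *\<^sub>R (y - x)" "x + b *\<^sub>R (y - x)"] t by simp
  qed auto
  moreover have "(?\<phi> has_real_derivative D \<bullet> (y - x)) (at 0)"
    using GDERIV_along_line [of f x 0 "y - x"] assms(2) by simp
  ultimately have "D \<bullet> (y - x) * (1 - 0) \<le> ?\<phi> 1 - ?\<phi> 0"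
    by (intro convex_on_imp_above_tangent [where A = UNIV]) auto
  then show ?thesis by simp
qed

text \<open>
  Only displacements inside block \<open>i\<close> occur, and on them just the \<open>i\<close>-th block of the gradient
  matters, so the block constant \<open>L\<close> replaces a global Lipschitz constant. The function
  \<open>t \<mapsto> f (x + t h) - t g(x) \<bullet> h - L/2 t\<^sup>2 |h|\<^sup>2\<close> has nonpositive derivative for \<open>t \<ge> 0\<close>.
\<close>

lemma block_descent:
  assumes grad: "\<And>x. GDERIV f x :> g x"
    and lip: "\<And>t. norm (block \<beta> i (g (x + t *\<^sub>R h)) - block \<beta> i (g x)) \<le> L * norm (t *\<^sub>R h)"
    and h: "h \<in> block_space \<beta> i"
  shows "f (x + h) \<le> f x + g x \<bullet> h + L / 2 * (norm h)\<^sup>2"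
proof -
  let ?\<phi> = "\<lambda>t. f (x + t *\<^sub>R h) - t * (g x \<bullet> h) - L / 2 * t\<^sup>2 * (norm h)\<^sup>2"
  have "?\<phi> 1 \<le> ?\<phi> 0"
  proof (rule DERIV_nonpos_imp_nonincreasing [of 0 1 ?\<phi>])
    fix t :: real assume t: "0 \<le> t" "t \<le> 1"
    let ?d = "g (x + t *\<^sub>R h) \<bullet> h - g x \<bullet> h - L * t * (norm h)\<^sup>2"
    have line: "((\<lambda>t. f (x + t *\<^sub>R h)) has_real_derivative g (x + t *\<^sub>R h) \<bullet> h) (at t)"
      by (rule GDERIV_along_line) (rule grad)
    have "(?\<phi> has_real_derivative ?d) (at t)"
      using line by (auto intro!: derivative_eq_intros)
    moreover have "g (x + t *\<^sub>R h) \<bullet> h - g x \<bullet> h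
        = (block \<beta> i (g (x + t *\<^sub>R h)) - block \<beta> i (g x)) \<bullet> h"
      using h by (simp add: inner_diff_left inner_block_space)
    moreover have "\<dots> \<le> (L * norm (t *\<^sub>R h)) * norm h"
      by (rule order_trans [OF norm_cauchy_schwarz mult_right_mono [OF lip]]) simp
    ultimately show "\<exists>y. (?\<phi> has_real_derivative y) (at t) \<and> y \<le> 0"
      using t by (intro exI [of _ ?d]) (simp add: power2_eq_square mult_ac)
  qed simp
  then show ?thesis by simp
qed

text \<open>
  First-order optimality in a form that avoids subdifferentials: the condition is used with \<open>t\<close> the
  fraction of the way from a minimizer to a competitor.
\<close>

lemma nonneg_slope_of_quadratic:
  fixes a b :: real
  assumes "\<And>t. 0 < t \<Longrightarrow> t \<le> 1 \<Longrightarrow> 0 \<le> t * a + t\<^sup>2 * b"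
  shows "0 \<le> a"
proof (rule ccontr)
  assume "\<not> 0 \<le> a"
  define m where "m = 2 * (\<bar>b\<bar> + 1)"
  define t where "t = min 1 (- a / m)"
  have "0 < m" by (simp add: m_def)
  have t: "0 < t" "t \<le> 1"
    using \<open>\<not> 0 \<le> a\<close> \<open>0 < m\<close> by (auto simp: t_def divide_neg_pos)
  have "t \<le> - a / m" by (simp add: t_def)
  then have "t * m \<le> - a" using \<open>0 < m\<close> by (simp only: pos_le_divide_eq)
  then have small: "t * (\<bar>b\<bar> + 1) \<le> - a / 2" by (simp add: m_def algebra_simps)
  have "t * b \<le> t * (\<bar>b\<bar> + 1)" using t by (intro mult_left_mono) auto
  with small \<open>\<not> 0 \<le> a\<close> have "a + t * b < 0" by linarith
  then have "t * (a + t * b) < 0" using t by (simp add: mult_pos_neg)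
  with assms [of t] t show False by (simp add: algebra_simps power2_eq_square)
qed

text \<open>
  In terms of reciprocals the recurrence implies \<open>1 / e\<^sub>k\<^sub>+\<^sub>1 \<ge> 1 / e\<^sub>k + \<alpha>\<close>, so \<open>e\<^sub>k\<close> decays like
  \<open>1 / (\<alpha> k)\<close>; the maximum also accommodates \<open>k = 0\<close>. The induction below multiplies out instead, so
  that \<open>e\<^sub>k = 0\<close> needs no separate treatment.
\<close>

lemma quadratic_decrease_rate:
  fixes e :: "nat \<Rightarrow> real"
  assumes "\<alpha> > 0" and nonneg: "\<And>k. 0 \<le> e k"
    and decr: "\<And>k. e (Suc k) \<le> e k - \<alpha> * (e k)\<^sup>2"
  shows "e k \<le> max (2 / \<alpha>) (e 0) / (real k + 1)"
proof -
  define C where "C = max (2 / \<alpha>) (e 0)"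
  have C: "C > 0" "2 \<le> \<alpha> * C" "e 0 \<le> C"
  proof -
    have "2 / \<alpha> \<le> C" "2 / \<alpha> > 0" using \<open>\<alpha> > 0\<close> by (auto simp: C_def)
    then show "C > 0" by linarith
    show "2 \<le> \<alpha> * C" using \<open>2 / \<alpha> \<le> C\<close> \<open>\<alpha> > 0\<close> by (simp add: field_simps)
    show "e 0 \<le> C" by (simp add: C_def)
  qed
  have "e k * (real k + 1) \<le> C"
  proof (induction k)
    case 0
    then show ?case using C by simp
  next
    case (Suc k)
    let ?n = "real k + 1" and ?a = "e k"
    have "?a\<^sup>2 * 2 \<le> ?a\<^sup>2 * (\<alpha> * C)" using C by (intro mult_left_mono) auto
    moreover have "e (Suc k) * C \<le> (?a - \<alpha> * ?a\<^sup>2) * C"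
      using decr [of k] C by (intro mult_right_mono) auto
    ultimately have "e (Suc k) * C \<le> ?a * C - 2 * ?a\<^sup>2"
      by (simp add: algebra_simps)
    then have "e (Suc k) * C * (?n + 1) \<le> (?a * C - 2 * ?a\<^sup>2) * (?n + 1)"
      by (rule mult_right_mono) simp
    also have "\<dots> \<le> C\<^sup>2"
    proof -
      \<comment> \<open>Both factors below are nonnegative because \<open>e k \<le> C / (k + 1) \<le> C\<close>.\<close>
      have "?a \<le> ?a * ?n" using nonneg [of k] by (simp add: distrib_left)
      then have "0 \<le> (C - ?a * ?n) * (C - ?a)"
        using Suc.IH by (intro mult_nonneg_nonneg) linarith+
      moreover have "0 \<le> ?n * ?a\<^sup>2" "0 \<le> ?a\<^sup>2" by simp_all
      moreover have "C\<^sup>2 - (?a * C - 2 * ?a\<^sup>2) * (?n + 1)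
          = (C - ?a * ?n) * (C - ?a) + ?n * ?a\<^sup>2 + 2 * ?a\<^sup>2"
        by algebra
      ultimately show ?thesis by linarith
    qed
    finally have "e (Suc k) * (?n + 1) * C \<le> C * C" by (simp add: mult_ac power2_eq_square)
    then have "e (Suc k) * (?n + 1) \<le> C" using C by simp
    then show ?case by (simp add: add_ac)
  qed
  then show ?thesis by (simp add: C_def pos_le_divide_eq)
qed

section \<open>Block proximal steps\<close>

text \<open>
  The differentiable part \<open>f\<close> and the separable, possibly infinite part \<open>\<psi>\<close>. Every point of interest
  lies in \<open>ereal_dom \<Psi>\<close>, where all terms are finite and the estimates can be carried out in the reals.
\<close>

locale composite_objective =
  fixes \<beta> :: "'n::finite \<Rightarrow> 'i::finite"
    and f :: "real ^ 'n \<Rightarrow> real" and g :: "real ^ 'n \<Rightarrow> real ^ 'n"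
    and \<psi> :: "'i \<Rightarrow> real ^ 'n \<Rightarrow> ereal"
  assumes proper: "\<And>i s. s \<in> block_space \<beta> i \<Longrightarrow> \<psi> i s \<noteq> -\<infinity>"
    and gradient: "\<And>x. GDERIV f x :> g x"
begin

abbreviation \<Psi> :: "real ^ 'n \<Rightarrow> ereal" where "\<Psi> \<equiv> block_sum \<beta> \<psi>"
abbreviation F :: "real ^ 'n \<Rightarrow> ereal" where "F \<equiv> objective \<beta> f \<psi>"
abbreviation \<psi>r :: "'i \<Rightarrow> real ^ 'n \<Rightarrow> real" where "\<psi>r i s \<equiv> real_of_ereal (\<psi> i s)"
abbreviation \<Psi>r :: "real ^ 'n \<Rightarrow> real" where "\<Psi>r x \<equiv> real_of_ereal (\<Psi> x)"

lemma dom_\<Psi>_iff: "x \<in> ereal_dom \<Psi> \<longleftrightarrow> (\<forall>i. \<psi> i (block \<beta> i x) \<noteq> \<infinity>)"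
  by (simp add: ereal_dom_def block_sum_def sum_Pinfty less_top flip: top_ereal_def)
     (simp add: top_ereal_def sum_Pinfty)

lemma \<psi>_eq_real: "x \<in> ereal_dom \<Psi> \<Longrightarrow> \<psi> i (block \<beta> i x) = ereal (\<psi>r i (block \<beta> i x))"
  using proper [of "block \<beta> i x" i]
  by (cases "\<psi> i (block \<beta> i x)") (auto simp: dom_\<Psi>_iff)

lemma \<Psi>_eq_sum:
  assumes "x \<in> ereal_dom \<Psi>"
  shows "\<Psi> x = ereal (\<Sum>i\<in>UNIV. \<psi>r i (block \<beta> i x))"
proof -
  have "\<Psi> x = (\<Sum>i\<in>UNIV. ereal (\<psi>r i (block \<beta> i x)))"
    unfolding block_sum_def by (intro sum.cong refl \<psi>_eq_real assms)
  then show ?thesis by simp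
qed

lemma \<Psi>_eq_real: "x \<in> ereal_dom \<Psi> \<Longrightarrow> ereal (\<Psi>r x) = \<Psi> x"
  by (simp add: \<Psi>_eq_sum)

lemma dom_F: "ereal_dom F = ereal_dom \<Psi>"
  by (auto simp: ereal_dom_def objective_def)

lemma F_eq_real: "x \<in> ereal_dom \<Psi> \<Longrightarrow> F x = ereal (f x + \<Psi>r x)"
  by (simp add: objective_def \<Psi>_eq_real flip: plus_ereal.simps(1))

lemma \<Psi>r_block_change:
  assumes "x \<in> ereal_dom \<Psi>" "x + s \<in> ereal_dom \<Psi>" "s \<in> block_space \<beta> i"
  shows "\<Psi>r (x + s) - \<psi>r i (block \<beta> i x + s) = \<Psi>r x - \<psi>r i (block \<beta> i x)"
proof -
  have "\<Psi>r (x + s) = \<psi>r i (block \<beta> i x + s) + (\<Sum>j\<in>UNIV - {i}. \<psi>r j (block \<beta> j (x + s)))"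
    using assms by (simp add: \<Psi>_eq_sum block_add block_of_block_space sum.remove [of UNIV i])
  moreover have "\<Psi>r x = \<psi>r i (block \<beta> i x) + (\<Sum>j\<in>UNIV - {i}. \<psi>r j (block \<beta> j x))"
    using assms by (simp add: \<Psi>_eq_sum sum.remove [of UNIV i])
  moreover have "(\<Sum>j\<in>UNIV - {i}. \<psi>r j (block \<beta> j (x + s))) = (\<Sum>j\<in>UNIV - {i}. \<psi>r j (block \<beta> j x))"
    using assms by (intro sum.cong) (auto simp: block_add block_of_block_space)
  ultimately show ?thesis by simp
qed

lemma trial_step_minimizes:
  assumes trial: "is_trial_step \<beta> g \<psi> \<theta> i x s" and x: "x \<in> ereal_dom \<Psi>"
  shows "s \<in> block_space \<beta> i" "x + s \<in> ereal_dom \<Psi>"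
    "\<And>u. u \<in> block_space \<beta> i \<Longrightarrow> \<psi> i (block \<beta> i x + u) \<noteq> \<infinity> \<Longrightarrow>
       g x \<bullet> s + \<theta> / 2 * (norm s)\<^sup>2 + \<psi>r i (block \<beta> i x + s)
         \<le> g x \<bullet> u + \<theta> / 2 * (norm u)\<^sup>2 + \<psi>r i (block \<beta> i x + u)"
proof -
  let ?Q = "\<lambda>s. ereal (block \<beta> i (g x) \<bullet> s + \<theta> / 2 * (norm s)\<^sup>2) + \<psi> i (block \<beta> i x + s)"
  have s: "s \<in> block_space \<beta> i" and min: "\<And>u. u \<in> block_space \<beta> i \<Longrightarrow> ?Q s \<le> ?Q u"
    using trial by (auto simp: is_trial_step_def is_arg_min_def not_less)
  show "s \<in> block_space \<beta> i" by fact
  have "?Q s \<le> ?Q 0" by (rule min) (simp add: block_space_def)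
  then have fin: "\<psi> i (block \<beta> i x + s) \<noteq> \<infinity>"
    using x by (auto simp: dom_\<Psi>_iff)
  then show "x + s \<in> ereal_dom \<Psi>"
    using x s by (auto simp: dom_\<Psi>_iff block_add block_of_block_space)
  have in_space: "block \<beta> i x + u \<in> block_space \<beta> i" if "u \<in> block_space \<beta> i" for u
    using that by (auto simp: block_space_def block_def)
  fix u assume u: "u \<in> block_space \<beta> i" "\<psi> i (block \<beta> i x + u) \<noteq> \<infinity>"
  have "\<psi> i (block \<beta> i x + u) = ereal (\<psi>r i (block \<beta> i x + u))"
    "\<psi> i (block \<beta> i x + s) = ereal (\<psi>r i (block \<beta> i x + s))"
    using u fin proper [OF in_space [OF u(1)]] proper [OF in_space [OF s]] by (auto simp: ereal_real)
  moreover have "?Q s \<le> ?Q u" using u by (intro min)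
  ultimately have "ereal (block \<beta> i (g x) \<bullet> s + \<theta> / 2 * (norm s)\<^sup>2) + ereal (\<psi>r i (block \<beta> i x + s))
     \<le> ereal (block \<beta> i (g x) \<bullet> u + \<theta> / 2 * (norm u)\<^sup>2) + ereal (\<psi>r i (block \<beta> i x + u))"
    by metis
  then show "g x \<bullet> s + \<theta> / 2 * (norm s)\<^sup>2 + \<psi>r i (block \<beta> i x + s)
         \<le> g x \<bullet> u + \<theta> / 2 * (norm u)\<^sup>2 + \<psi>r i (block \<beta> i x + u)"
    using s u by (simp add: inner_block_space)
qed

text \<open>
  By the descent lemma the model minimized by the trial step overestimates the change of the
  objective by at least \<open>(\<theta> - L) / 2 * (norm s)\<^sup>2\<close>, and the model value at \<open>s\<close> is at most that at \<open>0\<close>.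
\<close>

lemma trial_step_sufficient_decrease:
  assumes trial: "is_trial_step \<beta> g \<psi> \<theta> i x s" and x: "x \<in> ereal_dom \<Psi>"
    and lip: "\<And>h. h \<in> block_space \<beta> i \<Longrightarrow>
      norm (block \<beta> i (g (x + h)) - block \<beta> i (g x)) \<le> L * norm h"
    and \<theta>: "L + \<sigma> \<le> \<theta>"
  shows "sufficient_decrease F \<sigma> x s"
proof -
  note s = trial_step_minimizes [OF trial x]
  have "f (x + s) \<le> f x + g x \<bullet> s + L / 2 * (norm s)\<^sup>2"
    by (rule block_descent [OF gradient _ s(1)]) (intro lip scaleR_in_block_space s(1))
  moreover have "g x \<bullet> s + \<theta> / 2 * (norm s)\<^sup>2 + \<psi>r i (block \<beta> i x + s) \<le> \<psi>r i (block \<beta> i x)"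
    using s(3) [of 0] x by (simp add: block_space_def dom_\<Psi>_iff)
  moreover have "\<Psi>r (x + s) - \<psi>r i (block \<beta> i x + s) = \<Psi>r x - \<psi>r i (block \<beta> i x)"
    by (rule \<Psi>r_block_change [OF x s(2,1)])
  moreover have "(L + \<sigma>) * (norm s)\<^sup>2 \<le> \<theta> * (norm s)\<^sup>2"
    using \<theta> by (intro mult_right_mono) auto
  ultimately have "f (x + s) + \<Psi>r (x + s) \<le> f x + \<Psi>r x - \<sigma> / 2 * (norm s)\<^sup>2"
    by (simp add: algebra_simps)
  then show ?thesis
    using x s(2) by (simp add: sufficient_decrease_def F_eq_real)
qed

text \<open>
  If the accepted weight is not the initial one, the weight tried just before, smaller by the factor
  \<open>\<eta>\<close>, was rejected and hence was below \<open>L + \<sigma>\<close>.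
\<close>

lemma rnbpg_step_accepted:
  assumes step: "rnbpg_step \<beta> f g \<psi> \<eta> \<sigma> \<theta>lo \<theta>hi i x x'" and x: "x \<in> ereal_dom \<Psi>"
    and lip: "\<And>h. h \<in> block_space \<beta> i \<Longrightarrow>
      norm (block \<beta> i (g (x + h)) - block \<beta> i (g x)) \<le> L * norm h"
    and "\<eta> > 1" "0 < \<theta>lo"
  shows "\<exists>\<theta> s. 0 < \<theta> \<and> \<theta> \<le> max \<theta>hi (\<eta> * (L + \<sigma>)) \<and> is_trial_step \<beta> g \<psi> \<theta> i x s \<and>
    sufficient_decrease F \<sigma> x s \<and> x' = x + s"
proof -
  obtain \<theta>0 s J where \<theta>0: "\<theta>0 \<in> {\<theta>lo..\<theta>hi}"
    and trial: "\<And>j. j \<le> J \<Longrightarrow> is_trial_step \<beta> g \<psi> (\<theta>0 * \<eta> ^ j) i x (s j)"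
    and fail: "\<And>j. j < J \<Longrightarrow> \<not> sufficient_decrease F \<sigma> x (s j)"
    and succ: "sufficient_decrease F \<sigma> x (s J)" "x' = x + s J"
    using step unfolding rnbpg_step_def by blast
  have "\<theta>0 * \<eta> ^ J \<le> max \<theta>hi (\<eta> * (L + \<sigma>))"
  proof (cases J)
    case 0
    then show ?thesis using \<theta>0 by (simp add: le_max_iff_disj)
  next
    case (Suc j)
    have "\<theta>0 * \<eta> ^ j < L + \<sigma>"
      using trial_step_sufficient_decrease [OF trial x lip] fail Suc
      by (metis less_Suc_eq less_imp_le not_less)
    then have "\<eta> * (\<theta>0 * \<eta> ^ j) \<le> \<eta> * (L + \<sigma>)"
      using \<open>\<eta> > 1\<close> by (intro mult_left_mono) auto
    then show ?thesis by (simp add: Suc mult_ac)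
  qed
  moreover have "0 < \<theta>0 * \<eta> ^ J" using \<theta>0 \<open>\<eta> > 1\<close> \<open>0 < \<theta>lo\<close> by simp
  ultimately show ?thesis using trial [of J] succ by blast
qed

text \<open>
  The block steps taken from the same point \<open>x\<close> jointly minimize
  \<open>g(x) \<bullet> w + \<Sum>\<^sub>i \<theta>\<^sub>i / 2 * |w\<^sub>i|\<^sup>2 + \<Psi>(x + w)\<close> over \<open>w\<close>. Moving from the minimizer \<open>d\<close> a
  fraction \<open>t\<close> towards \<open>y - x\<close> cannot decrease this value, and convexity bounds \<open>\<Psi>\<close> along the way
  linearly in \<open>t\<close>. Letting \<open>t\<close> tend to \<open>0\<close> gives the inequality.
\<close>

lemma trial_steps_subgradient:
  assumes conv: "ereal_convex \<Psi>"
    and trial: "\<And>i. is_trial_step \<beta> g \<psi> (\<theta> i) i x (s i)" and x: "x \<in> ereal_dom \<Psi>"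
    and y: "y \<in> ereal_dom \<Psi>"
    and d: "d = (\<Sum>i\<in>UNIV. s i)" and u: "u = (\<Sum>i\<in>UNIV. \<theta> i *\<^sub>R s i)"
  shows "x + d \<in> ereal_dom \<Psi>"
    and "\<Psi>r (x + d) \<le> \<Psi>r y + (g x + u) \<bullet> (y - (x + d))"
proof -
  note s = trial_step_minimizes [OF trial x]
  have block_d: "block \<beta> i d = s i" for i
    unfolding d by (rule block_sum_block_space [OF s(1)])
  show dom_d: "x + d \<in> ereal_dom \<Psi>"
    unfolding dom_\<Psi>_iff
  proof
    fix i
    show "\<psi> i (block \<beta> i (x + d)) \<noteq> \<infinity>"
      using s(2) [of i] s(1) [of i] by (auto simp: dom_\<Psi>_iff block_add block_d block_of_block_space dest: spec [of _ i])
  qed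
  define v where "v = y - (x + d)"
  let ?b = "(\<Sum>i\<in>UNIV. \<theta> i / 2 * (norm (block \<beta> i v))\<^sup>2)"
  have "0 \<le> t * ((g x + u) \<bullet> v + (\<Psi>r y - \<Psi>r (x + d))) + t\<^sup>2 * ?b" if t: "0 < t" "t \<le> 1" for t
  proof -
    define w where "w = x + d + t *\<^sub>R v"
    have "w = (1 - t) *\<^sub>R (x + d) + t *\<^sub>R y" by (simp add: w_def v_def algebra_simps)
    then have "\<Psi> w \<le> ereal (1 - t) * \<Psi> (x + d) + ereal t * \<Psi> y"
      using conv t unfolding ereal_convex_def by (metis atLeastAtMost_iff less_imp_le)
    then have le: "\<Psi> w \<le> ereal ((1 - t) * \<Psi>r (x + d) + t * \<Psi>r y)"
      by (simp add: \<Psi>_eq_real dom_d y flip: plus_ereal.simps(1) times_ereal.simps(1))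
    then have w: "w \<in> ereal_dom \<Psi>"
      by (auto simp: ereal_dom_def)
    then have \<Psi>_w: "\<Psi>r w \<le> (1 - t) * \<Psi>r (x + d) + t * \<Psi>r y"
      using le by (subst (asm) \<Psi>_eq_real [OF w, symmetric]) (simp only: ereal_less_eq)
    have block_w: "block \<beta> i w = block \<beta> i x + (s i + t *\<^sub>R block \<beta> i v)" for i
      by (simp add: w_def block_add block_scaleR block_d)
    have min: "g x \<bullet> s i + \<theta> i / 2 * (norm (s i))\<^sup>2 + \<psi>r i (block \<beta> i (x + d))
        \<le> g x \<bullet> (s i + t *\<^sub>R block \<beta> i v) + \<theta> i / 2 * (norm (s i + t *\<^sub>R block \<beta> i v))\<^sup>2
          + \<psi>r i (block \<beta> i w)" for i
    proof -
      have "s i + t *\<^sub>R block \<beta> i v \<in> block_space \<beta> i"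
        using s(1) [of i] by (auto simp: block_space_def block_def)
      moreover have "\<psi> i (block \<beta> i x + (s i + t *\<^sub>R block \<beta> i v)) \<noteq> \<infinity>"
        using w by (simp add: dom_\<Psi>_iff block_w)
      ultimately show ?thesis
        using s(3) [of "s i + t *\<^sub>R block \<beta> i v" i] by (simp add: block_w block_add block_d)
    qed
    have "0 \<le> t * (g x \<bullet> block \<beta> i v + \<theta> i * (s i \<bullet> block \<beta> i v))
        + t\<^sup>2 * (\<theta> i / 2 * (norm (block \<beta> i v))\<^sup>2) + (\<psi>r i (block \<beta> i w) - \<psi>r i (block \<beta> i (x + d)))" for i
    proof -
      have "(norm (s i + t *\<^sub>R block \<beta> i v))\<^sup>2
          = (norm (s i))\<^sup>2 + 2 * t * (s i \<bullet> block \<beta> i v) + t\<^sup>2 * (norm (block \<beta> i v))\<^sup>2"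
        unfolding power2_norm_eq_inner
        by (simp add: inner_add_left inner_add_right inner_commute [of "block \<beta> i v" "s i"]
            power2_eq_square algebra_simps)
      with min [of i] show ?thesis
        by (simp only: inner_add_right inner_scaleR_right distrib_left) (simp add: algebra_simps)
    qed
    then have "0 \<le> (\<Sum>i\<in>UNIV. t * (g x \<bullet> block \<beta> i v + \<theta> i * (s i \<bullet> block \<beta> i v))
        + t\<^sup>2 * (\<theta> i / 2 * (norm (block \<beta> i v))\<^sup>2) + (\<psi>r i (block \<beta> i w) - \<psi>r i (block \<beta> i (x + d))))"
      by (rule sum_nonneg)
    also have "\<dots> = t * ((\<Sum>i\<in>UNIV. g x \<bullet> block \<beta> i v) + (\<Sum>i\<in>UNIV. \<theta> i * (s i \<bullet> block \<beta> i v)))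
        + t\<^sup>2 * ?b + (\<Psi>r w - \<Psi>r (x + d))"
    proof -
      have "\<Psi>r w - \<Psi>r (x + d) = (\<Sum>i\<in>UNIV. \<psi>r i (block \<beta> i w) - \<psi>r i (block \<beta> i (x + d)))"
        unfolding \<Psi>_eq_sum [OF w] \<Psi>_eq_sum [OF dom_d] by (simp add: sum_subtractf)
      then show ?thesis
        by (simp only: sum.distrib sum_distrib_left [symmetric])
    qed
    also have "(\<Sum>i\<in>UNIV. g x \<bullet> block \<beta> i v) = g x \<bullet> v"
      by (simp only: inner_sum_right [symmetric] sum_block)
    also have "(\<Sum>i\<in>UNIV. \<theta> i * (s i \<bullet> block \<beta> i v)) = u \<bullet> v"
    proof -
      have "s i \<bullet> block \<beta> i v = s i \<bullet> v" for i
        using inner_block_space [OF s(1) [of i], of v] by (simp add: inner_commute)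
      then show ?thesis by (simp only: u inner_sum_left inner_scaleR_left)
    qed
    finally have "0 \<le> t * ((g x + u) \<bullet> v) + t\<^sup>2 * ?b + (\<Psi>r w - \<Psi>r (x + d))"
      by (simp only: inner_add_left)
    with \<Psi>_w have "0 \<le> t * ((g x + u) \<bullet> v) + t\<^sup>2 * ?b
        + ((1 - t) * \<Psi>r (x + d) + t * \<Psi>r y - \<Psi>r (x + d))"
      by linarith
    also have "\<dots> = t * ((g x + u) \<bullet> v + (\<Psi>r y - \<Psi>r (x + d))) + t\<^sup>2 * ?b"
      by algebra
    finally show ?thesis .
  qed
  then have "0 \<le> (g x + u) \<bullet> v + (\<Psi>r y - \<Psi>r (x + d))"
    by (rule nonneg_slope_of_quadratic)
  then show "\<Psi>r (x + d) \<le> \<Psi>r y + (g x + u) \<bullet> (y - (x + d))"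
    by (simp add: v_def)
qed

text \<open>
  The gradient inequality at \<open>x\<close> and the subgradient inequality at \<open>x + d\<close> are added. The term
  \<open>- u \<bullet> d\<close> has a favourable sign, and the remaining inner products are estimated by Cauchy-Schwarz.
\<close>

lemma optimality_gap_le:
  assumes f_convex: "convex_on UNIV f" and \<Psi>_convex: "ereal_convex \<Psi>"
    and trial: "\<And>i. is_trial_step \<beta> g \<psi> (\<theta> i) i x (s i)" and x: "x \<in> ereal_dom \<Psi>"
    and \<theta>: "\<And>i. 0 \<le> \<theta> i" "\<And>i. \<theta> i \<le> c" and y: "y \<in> ereal_dom \<Psi>"
    and d: "d = (\<Sum>i\<in>UNIV. s i)" and lip: "\<Psi>r x - \<Psi>r (x + d) \<le> L\<Psi> * norm d"
  shows "f x + \<Psi>r x - (f y + \<Psi>r y) \<le> (L\<Psi> + norm (g x) + c * norm (x - y)) * norm d"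
proof -
  define u where "u = (\<Sum>i\<in>UNIV. \<theta> i *\<^sub>R s i)"
  note s = trial_step_minimizes(1) [OF trial x]
  have block_d: "block \<beta> i d = s i" and block_u: "block \<beta> i u = \<theta> i *\<^sub>R s i" for i
    unfolding d u_def by (intro block_sum_block_space scaleR_in_block_space s)+
  have "0 \<le> c" using \<theta> order_trans by blast
  have "(norm u)\<^sup>2 \<le> (c * norm d)\<^sup>2"
  proof -
    have "(norm u)\<^sup>2 = (\<Sum>i\<in>UNIV. (\<theta> i)\<^sup>2 * (norm (s i))\<^sup>2)"
      by (simp add: sum_norm_block [of \<beta> u, symmetric] block_u power_mult_distrib)
    also have "\<dots> \<le> (\<Sum>i\<in>UNIV. c\<^sup>2 * (norm (s i))\<^sup>2)"
      using \<theta> by (intro sum_mono mult_right_mono power_mono) auto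
    also have "\<dots> = c\<^sup>2 * (norm d)\<^sup>2"
      by (simp add: sum_norm_block [of \<beta> d, symmetric] block_d sum_distrib_left)
    finally show ?thesis by (simp add: power_mult_distrib)
  qed
  then have norm_u: "norm u \<le> c * norm d"
    by (rule power2_le_imp_le) (simp add: \<open>0 \<le> c\<close>)
  have "u \<bullet> d = (\<Sum>i\<in>UNIV. \<theta> i * (norm (s i))\<^sup>2)"
    by (simp add: sum_inner_block [of \<beta> u d, symmetric] block_u block_d power2_norm_eq_inner)
  then have ud: "0 \<le> u \<bullet> d"
    using \<theta> by (simp add: sum_nonneg)
  have "f x + g x \<bullet> (y - x) \<le> f y"
    by (rule convex_on_gradient_inequality [OF f_convex gradient])
  moreover have "\<Psi>r (x + d) \<le> \<Psi>r y + (g x + u) \<bullet> (y - (x + d))"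
    by (rule trial_steps_subgradient(2) [OF \<Psi>_convex trial x y d u_def])
  moreover have "(g x + u) \<bullet> (y - (x + d)) = g x \<bullet> (y - x) - g x \<bullet> d + u \<bullet> (y - x) - u \<bullet> d"
    by (simp add: inner_add_left inner_add_right inner_diff_right)
  moreover have "- (g x \<bullet> d) \<le> norm (g x) * norm d"
    using norm_cauchy_schwarz [of "- g x" d] by simp
  moreover have "u \<bullet> (y - x) \<le> c * norm d * norm (x - y)"
  proof -
    have "u \<bullet> (y - x) \<le> norm u * norm (y - x)" by (rule norm_cauchy_schwarz)
    also have "\<dots> \<le> c * norm d * norm (y - x)" by (intro mult_right_mono norm_u) simp
    finally show ?thesis by (simp add: norm_minus_commute)
  qed
  ultimately have "f x + \<Psi>r x - (f y + \<Psi>r y)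
      \<le> L\<Psi> * norm d + norm (g x) * norm d + c * norm d * norm (x - y)"
    using lip ud by linarith
  then show ?thesis by (simp add: algebra_simps)
qed

text \<open>
  The bound for a single \<open>y\<close> is affine in the distance from \<open>x\<close> to \<open>y\<close>, so it passes to the infimum
  over \<open>S\<close> whether or not a nearest point exists.
\<close>

lemma optimality_gap_le_step_norm:
  assumes f_convex: "convex_on UNIV f" and \<Psi>_convex: "ereal_convex \<Psi>"
    and trial: "\<And>i. is_trial_step \<beta> g \<psi> (\<theta> i) i x (s i)" and x: "x \<in> ereal_dom \<Psi>"
    and \<theta>: "\<And>i. 0 \<le> \<theta> i" "\<And>i. \<theta> i \<le> c" and "0 < c"
    and S: "S \<noteq> {}" "\<And>y. y \<in> S \<Longrightarrow> y \<in> ereal_dom \<Psi>" "\<And>y. y \<in> S \<Longrightarrow> f y + \<Psi>r y = Fstar"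
    and r: "infdist x S \<le> r" and q: "norm (g x) \<le> q"
    and d: "d = (\<Sum>i\<in>UNIV. s i)" and lip: "\<Psi>r x - \<Psi>r (x + d) \<le> L\<Psi> * norm d"
  shows "f x + \<Psi>r x - Fstar \<le> (L\<Psi> + q + c * r) * norm d"
proof -
  let ?gap = "f x + \<Psi>r x - Fstar"
  have bound: "?gap \<le> (L\<Psi> + q) * norm d + c * norm d * dist x y" if "y \<in> S" for y
  proof -
    have "?gap \<le> (L\<Psi> + norm (g x) + c * norm (x - y)) * norm d"
      using optimality_gap_le [OF f_convex \<Psi>_convex trial x \<theta> S(2) [OF that] d lip] S(3) [OF that]
      by simp
    also have "\<dots> \<le> (L\<Psi> + q + c * norm (x - y)) * norm d"
      using q by (intro mult_right_mono) auto
    finally show ?thesis by (simp add: dist_norm algebra_simps)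
  qed
  show ?thesis
  proof (cases "d = 0")
    case True
    then show ?thesis using bound S(1) by auto
  next
    case False
    then have pos: "0 < c * norm d" using \<open>0 < c\<close> by simp
    \<comment> \<open>Solved for the distance, the bound is a lower bound valid for every \<open>y\<close> in \<open>S\<close>.\<close>
    have "(?gap - (L\<Psi> + q) * norm d) / (c * norm d) \<le> infdist x S"
      unfolding infdist_notempty [OF S(1)]
    proof (rule cINF_greatest [OF S(1)])
      fix y assume "y \<in> S"
      show "(?gap - (L\<Psi> + q) * norm d) / (c * norm d) \<le> dist x y"
        using bound [OF \<open>y \<in> S\<close>] pos by (simp add: pos_divide_le_eq mult_ac)
    qed
    with r have "(?gap - (L\<Psi> + q) * norm d) / (c * norm d) \<le> r" by simp
    then have "?gap - (L\<Psi> + q) * norm d \<le> r * (c * norm d)"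
      using pos by (simp only: pos_divide_le_eq)
    then show ?thesis by (simp add: algebra_simps)
  qed
qed

end

section \<open>Expectation over histories\<close>

lemma finite_histories: "finite {h :: 'a::finite list. length h = k}"
  using finite_lists_length_eq [of "UNIV :: 'a set" k] by simp

text \<open>
  The expectation of \<open>G\<close> when \<open>k\<close> indices are drawn independently with probabilities \<open>p\<close>.
\<close>

definition history_expectation :: "('a::finite \<Rightarrow> real) \<Rightarrow> nat \<Rightarrow> ('a list \<Rightarrow> real) \<Rightarrow> real" where
  "history_expectation p k G = (\<Sum>h | length h = k. prod_list (map p h) * G h)"

lemma history_expectation_0 [simp]: "history_expectation p 0 G = G []"
  by (simp add: history_expectation_def)

text \<open>
  The tower property: the last index is averaged out first.
\<close>

lemma history_expectation_Suc:
  "history_expectation p (Suc k) G = history_expectation p k (\<lambda>h. \<Sum>i\<in>UNIV. p i * G (h @ [i]))"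
proof -
  let ?H = "{h :: 'a list. length h = k}"
  have img: "{h :: 'a list. length h = Suc k} = (\<lambda>(h, i). h @ [i]) ` (?H \<times> UNIV)"
  proof (intro set_eqI iffI)
    fix h :: "'a list" assume "h \<in> {h. length h = Suc k}"
    then have "h = butlast h @ [last h]" "length (butlast h) = k"
      by (cases h rule: rev_cases; simp)+
    then show "h \<in> (\<lambda>(h, i). h @ [i]) ` (?H \<times> UNIV)"
      by (metis (mono_tags, lifting) SigmaI UNIV_I case_prod_conv image_eqI mem_Collect_eq)
  qed auto
  have "inj_on (\<lambda>(h :: 'a list, i). h @ [i]) (?H \<times> UNIV)"
    by (auto simp: inj_on_def)
  then have "history_expectation p (Suc k) G
      = (\<Sum>(h, i)\<in>?H \<times> UNIV. prod_list (map p h) * (p i * G (h @ [i])))"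
    by (simp add: history_expectation_def img sum.reindex case_prod_unfold mult.assoc)
  also have "\<dots> = history_expectation p k (\<lambda>h. \<Sum>i\<in>UNIV. p i * G (h @ [i]))"
    by (simp add: history_expectation_def sum.cartesian_product [symmetric] sum_distrib_left)
  finally show ?thesis .
qed

lemma history_expectation_const:
  assumes "(\<Sum>i\<in>UNIV. p i) = 1"
  shows "history_expectation p k (\<lambda>_. a) = a"
  using assms by (induction k) (simp_all add: history_expectation_Suc sum_distrib_right [symmetric])

lemma history_weight_nonneg:
  fixes p :: "'a \<Rightarrow> real"
  assumes "\<And>i. 0 \<le> p i"
  shows "0 \<le> prod_list (map p h)"
  using assms by (induction h) auto

lemma history_expectation_mono:
  assumes "\<And>i. 0 \<le> p i" "\<And>h. G h \<le> H h"
  shows "history_expectation p k G \<le> history_expectation p k H"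
  unfolding history_expectation_def
  by (intro sum_mono mult_left_mono assms history_weight_nonneg)

lemma history_expectation_diff:
  "history_expectation p k (\<lambda>h. G h - a * H h)
    = history_expectation p k G - a * history_expectation p k H"
  by (simp add: history_expectation_def sum_subtractf sum_distrib_left right_diff_distrib mult_ac)

text \<open>
  Jensen's inequality for the square, that is, nonnegativity of the variance.
\<close>

lemma history_expectation_power2_le:
  assumes p: "\<And>i. 0 \<le> p i" "(\<Sum>i\<in>UNIV. p i) = 1"
  shows "(history_expectation p k G)\<^sup>2 \<le> history_expectation p k (\<lambda>h. (G h)\<^sup>2)"
proof -
  let ?m = "history_expectation p k G"
  \<comment> \<open>The right-hand side is the expansion of the square of \<open>G h - ?m\<close>, shaped for linearity.\<close>
  have "history_expectation p k (\<lambda>_. 0) \<le> history_expectation p k (\<lambda>h. ((G h)\<^sup>2 - (2 * ?m) * G h) - (-1) * ?m\<^sup>2)"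
  proof (rule history_expectation_mono [OF p(1)])
    fix h
    have "0 \<le> (G h - ?m)\<^sup>2" by simp
    then show "0 \<le> ((G h)\<^sup>2 - (2 * ?m) * G h) - (-1) * ?m\<^sup>2"
      by (simp add: power2_diff mult_ac)
  qed
  then have "0 \<le> history_expectation p k (\<lambda>h. (G h)\<^sup>2) - 2 * ?m * ?m + ?m\<^sup>2"
    by (simp only: history_expectation_diff history_expectation_const [OF p(2)])
  then show ?thesis by (simp add: power2_eq_square)
qed

text \<open>
  The events that prescribe the successive indices are independent, so their probabilities multiply.
  The empty history is separate because products over independent events need a nonempty index set.
\<close>

lemma (in prob_space) prob_history:
  fixes I :: "nat \<Rightarrow> 'a \<Rightarrow> 'i::finite"
  assumes indep: "indep_vars (\<lambda>_. count_space UNIV) I UNIV"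
    and distr: "\<And>k i. prob {\<omega> \<in> space M. I k \<omega> = i} = p i"
    and "length h = k"
  shows "prob {\<omega> \<in> space M. map (\<lambda>j. I j \<omega>) [0..<k] = h} = prod_list (map p h)"
proof (cases "k = 0")
  case True
  then show ?thesis using \<open>length h = k\<close> by (simp add: prob_space)
next
  case False
  have "{\<omega> \<in> space M. map (\<lambda>j. I j \<omega>) [0..<k] = h} = (\<Inter>j\<in>{..<k}. I j -` {h ! j} \<inter> space M)"
    using \<open>length h = k\<close> False by (auto simp: list_eq_iff_nth_eq)
  then have "prob {\<omega> \<in> space M. map (\<lambda>j. I j \<omega>) [0..<k] = h}
      = (\<Prod>j<k. prob (I j -` {h ! j} \<inter> space M))"
    using False by (simp only:) (intro indep_varsD [OF indep], auto)
  also have "\<dots> = (\<Prod>j<k. p (h ! j))"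
  proof (rule prod.cong [OF refl])
    fix j
    have "I j -` {h ! j} \<inter> space M = {\<omega> \<in> space M. I j \<omega> = h ! j}" by auto
    then show "prob (I j -` {h ! j} \<inter> space M) = p (h ! j)" by (simp add: distr)
  qed
  also have "\<dots> = prod_list (map p h)"
    using \<open>length h = k\<close> by (simp add: prod.list_conv_set_nth atLeast0LessThan)
  finally show ?thesis .
qed

lemma (in prob_space) expectation_history:
  fixes I :: "nat \<Rightarrow> 'a \<Rightarrow> 'i::finite"
  assumes indep: "indep_vars (\<lambda>_. count_space UNIV) I UNIV"
    and distr: "\<And>k i. prob {\<omega> \<in> space M. I k \<omega> = i} = p i"
  shows "(LINT \<omega>|M. G (map (\<lambda>j. I j \<omega>) [0..<k])) = history_expectation p k G"
proof -
  let ?Y = "\<lambda>\<omega>. map (\<lambda>j. I j \<omega>) [0..<k]"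
  let ?E = "\<lambda>h. {\<omega> \<in> space M. ?Y \<omega> = h}"
  have [measurable]: "I j \<in> measurable M (count_space UNIV)" for j
    using indep by (simp add: indep_vars_def2)
  have meas: "?E h \<in> events" for h
  proof -
    have "?E h = {\<omega> \<in> space M. length h = k \<and> (\<forall>j<k. I j \<omega> = h ! j)}"
      by (auto simp: list_eq_iff_nth_eq)
    also have "\<dots> \<in> events" by measurable
    finally show ?thesis .
  qed
  have "(LINT \<omega>|M. G (?Y \<omega>)) = (LINT \<omega>|M. (\<Sum>h | length h = k. G h * indicator (?E h) \<omega>))"
  proof (intro Bochner_Integration.integral_cong refl)
    fix \<omega> assume "\<omega> \<in> space M"
    then have "(\<Sum>h | length h = k. G h * indicator (?E h) \<omega>)
        = (\<Sum>h | length h = k. if ?Y \<omega> = h then G h else 0)"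
      by (intro sum.cong) (auto simp: indicator_def)
    then show "G (?Y \<omega>) = (\<Sum>h | length h = k. G h * indicator (?E h) \<omega>)"
      by (simp add: finite_histories)
  qed
  also have "\<dots> = (\<Sum>h | length h = k. G h * prob (?E h))"
  proof -
    have "integrable M (\<lambda>\<omega>. G h * indicator (?E h) \<omega>)" for h
      by (simp add: meas less_top [symmetric])
    then show ?thesis
      by (simp add: meas)
  qed
  also have "\<dots> = history_expectation p k G"
    unfolding history_expectation_def
    by (intro sum.cong refl) (simp add: prob_history [OF indep distr] mult.commute)
  finally show ?thesis .
qed

section \<open>The rate\<close>

text \<open>
  On average the decrease is at least \<open>\<sigma> / 2 * m * D\<^sup>2\<close> with \<open>m\<close> the least probability, and
  \<open>D \<ge> e / K\<close>. The estimate \<open>m\<^sup>2 \<le> m\<close> puts it into the form with \<open>m\<^sup>2\<close>.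
\<close>

lemma expected_gap_decrease:
  fixes p :: "'i::finite \<Rightarrow> real" and s :: "'i \<Rightarrow> 'a::real_normed_vector"
  assumes p: "\<And>i. 0 < p i" "(\<Sum>i\<in>UNIV. p i) = 1" and "0 < \<sigma>" "0 < K" "0 \<le> e"
    and step: "\<And>i. e' i \<le> e - \<sigma> / 2 * (norm (s i))\<^sup>2"
    and d: "D\<^sup>2 = (\<Sum>i\<in>UNIV. (norm (s i))\<^sup>2)"
    and gap: "e \<le> K * D"
  shows "(\<Sum>i\<in>UNIV. p i * e' i) \<le> e - \<sigma> * (Min (range p))\<^sup>2 / (2 * K\<^sup>2) * e\<^sup>2"
proof -
  define m where "m = Min (range p)"
  have m: "m \<le> p i" for i by (simp add: m_def)
  have "0 < m" using p(1) by (simp add: m_def)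
  have "m \<le> 1"
    using m [of undefined] member_le_sum [of undefined UNIV p] p by (simp add: less_imp_le)
  have "e\<^sup>2 \<le> K\<^sup>2 * D\<^sup>2"
    using power_mono [OF gap \<open>0 \<le> e\<close>, of 2] by (simp add: power_mult_distrib)
  then have "e\<^sup>2 / K\<^sup>2 \<le> D\<^sup>2"
    using \<open>0 < K\<close> by (simp add: pos_divide_le_eq mult.commute)
  moreover have "m\<^sup>2 \<le> m"
    using \<open>0 < m\<close> \<open>m \<le> 1\<close> by (simp add: power2_eq_square mult_left_le)
  ultimately have "m\<^sup>2 * (e\<^sup>2 / K\<^sup>2) \<le> m * D\<^sup>2"
    using \<open>0 < m\<close> by (intro mult_mono) auto
  also have "\<dots> \<le> (\<Sum>i\<in>UNIV. p i * (norm (s i))\<^sup>2)"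
    unfolding d sum_distrib_left by (intro sum_mono mult_right_mono m) simp
  finally have main: "\<sigma> / 2 * (m\<^sup>2 * (e\<^sup>2 / K\<^sup>2)) \<le> \<sigma> / 2 * (\<Sum>i\<in>UNIV. p i * (norm (s i))\<^sup>2)"
    using \<open>0 < \<sigma>\<close> by (intro mult_left_mono) auto
  have "(\<Sum>i\<in>UNIV. p i * e' i) \<le> (\<Sum>i\<in>UNIV. p i * (e - \<sigma> / 2 * (norm (s i))\<^sup>2))"
    using p(1) by (intro sum_mono mult_left_mono step) (simp add: less_imp_le)
  also have "\<dots> = (\<Sum>i\<in>UNIV. p i) * e - \<sigma> / 2 * (\<Sum>i\<in>UNIV. p i * (norm (s i))\<^sup>2)"
    by (simp add: right_diff_distrib sum_subtractf sum_distrib_left sum_distrib_right mult.left_commute)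
  also have "\<dots> \<le> e - \<sigma> / 2 * (m\<^sup>2 * (e\<^sup>2 / K\<^sup>2))"
    using main p(2) by simp
  also have "\<dots> = e - \<sigma> * m\<^sup>2 / (2 * K\<^sup>2) * e\<^sup>2"
    by simp
  finally show ?thesis by (simp only: m_def)
qed

lemma history_expectation_rate:
  assumes p: "\<And>i. 0 \<le> p i" "(\<Sum>i\<in>UNIV. p i) = 1" and "0 < \<alpha>" and nonneg: "\<And>h. 0 \<le> e h"
    and decr: "\<And>h. (\<Sum>i\<in>UNIV. p i * e (h @ [i])) \<le> e h - \<alpha> * (e h)\<^sup>2"
  shows "history_expectation p k e \<le> max (2 / \<alpha>) (e []) / (real k + 1)"
proof -
  have "history_expectation p k e \<le> max (2 / \<alpha>) (history_expectation p 0 e) / (real k + 1)"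
  proof (rule quadratic_decrease_rate [OF \<open>0 < \<alpha>\<close>])
    fix k
    show "0 \<le> history_expectation p k e"
      using history_expectation_mono [where p = p and G = "\<lambda>_. 0" and H = e and k = k, OF p(1)] nonneg
      by (simp add: history_expectation_const [OF p(2)])
    have "history_expectation p (Suc k) e \<le> history_expectation p k (\<lambda>h. e h - \<alpha> * (e h)\<^sup>2)"
      unfolding history_expectation_Suc by (intro history_expectation_mono p decr)
    also have "\<dots> = history_expectation p k e - \<alpha> * history_expectation p k (\<lambda>h. (e h)\<^sup>2)"
      by (rule history_expectation_diff)
    also have "\<dots> \<le> history_expectation p k e - \<alpha> * (history_expectation p k e)\<^sup>2"
      using history_expectation_power2_le [OF p] \<open>0 < \<alpha>\<close> by simp
    finally show "history_expectation p (Suc k) e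
        \<le> history_expectation p k e - \<alpha> * (history_expectation p k e)\<^sup>2" .
  qed
  then show ?thesis by simp
qed

theorem theorem3p3:
  fixes \<beta> :: "'n::finite \<Rightarrow> 'i::finite"
    and f :: "real ^ 'n \<Rightarrow> real" and g :: "real ^ 'n \<Rightarrow> real ^ 'n"
    and \<psi> :: "'i \<Rightarrow> real ^ 'n \<Rightarrow> ereal"
    and \<Psi> F :: "real ^ 'n \<Rightarrow> ereal"
    and L p :: "'i \<Rightarrow> real"
    and \<eta> \<sigma> \<theta>lo \<theta>hi c r q L\<Psi> \<alpha> Fstar :: real
    and x0 :: "real ^ 'n" and X :: "'i list \<Rightarrow> real ^ 'n"
    and M :: "'w measure" and I :: "nat \<Rightarrow> 'w \<Rightarrow> 'i"
    and k :: nat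
  assumes partition: "surj \<beta>"
    and \<psi>_proper: "\<And>i s. s \<in> block_space \<beta> i \<Longrightarrow> \<psi> i s \<noteq> -\<infinity>"
    and \<Psi>_eq: "\<Psi> = block_sum \<beta> \<psi>"
    and F_eq: "F = objective \<beta> f \<psi>"
    and gradient: "\<And>x. GDERIV f x :> g x"
    and L_pos: "\<And>i. L i > 0"
    and block_lipschitz: "\<And>x i h. h \<in> block_space \<beta> i \<Longrightarrow>
      norm (block \<beta> i (g (x + h)) - block \<beta> i (g x)) \<le> L i * norm h"
    and optimal_nonempty: "optimal_set F \<noteq> {}"
    and Fstar_eq: "ereal Fstar = optimal_value F"
    and f_convex: "convex_on UNIV f"
    and \<Psi>_convex: "ereal_convex \<Psi>"
    and x0_dom: "x0 \<in> ereal_dom F"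
    and params: "\<eta> > 1" "\<sigma> > 0" "0 < \<theta>lo" "\<theta>lo \<le> \<theta>hi"
    and p_bounds: "\<And>i. 0 < p i" "\<And>i. p i < 1"
    and p_sum: "(\<Sum>i\<in>UNIV. p i) = 1"
    and c_eq: "c = max \<theta>hi (\<eta> * (Max (range L) + \<sigma>))"
    and r_finite: "bdd_above ((\<lambda>x. infdist x (optimal_set F)) ` level_set F x0)"
    and r_eq: "r = (SUP x\<in>level_set F x0. infdist x (optimal_set F))"
    and q_finite: "bdd_above ((\<lambda>x. norm (g x)) ` level_set F x0)"
    and q_eq: "q = (SUP x\<in>level_set F x0. norm (g x))"
    and L\<Psi>_pos: "L\<Psi> > 0"
    and \<Psi>_lipschitz: "\<And>x y. x \<in> ereal_dom \<Psi> \<Longrightarrow> y \<in> ereal_dom \<Psi> \<Longrightarrow>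
      \<bar>\<Psi> x - \<Psi> y\<bar> \<le> ereal (L\<Psi> * norm (x - y))"
    and run: "rnbpg_run \<beta> f g \<psi> \<eta> \<sigma> \<theta>lo \<theta>hi x0 X"
    and prob: "prob_space M"
    and indices_indep: "prob_space.indep_vars M (\<lambda>_. count_space UNIV) I UNIV"
    and indices_distr: "\<And>k i. measure M {\<omega> \<in> space M. I k \<omega> = i} = p i"
    and \<alpha>_eq: "\<alpha> = \<sigma> * (Min (range p))\<^sup>2 / (2 * (L\<Psi> + q + c * r)\<^sup>2)"
  shows "(LINT \<omega>|M. real_of_ereal (F (X (map (\<lambda>j. I j \<omega>) [0..<k])))) - Fstar
    \<le> max (2 / \<alpha>) (real_of_ereal (F x0) - Fstar) / (real k + 1)"
proof -
  interpret prob_space M by (rule prob)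
  interpret composite_objective \<beta> f g \<psi>
    rewrites "block_sum \<beta> \<psi> \<equiv> \<Psi>" and "objective \<beta> f \<psi> \<equiv> F"
    by unfold_locales (simp_all add: \<psi>_proper gradient \<Psi>_eq F_eq)
  define K where "K = L\<Psi> + q + c * r"
  define e where "e h = real_of_ereal (F (X h)) - Fstar" for h
  have in_level: "X h \<in> level_set F x0" for h
    using rnbpg_run_objective_le [OF run \<open>\<sigma> > 0\<close>] by (simp add: level_set_def F_eq)
  have in_dom: "X h \<in> ereal_dom \<Psi>" for h
  proof -
    have "F (X h) < \<infinity>"
      using in_level [of h] x0_dom unfolding level_set_def ereal_dom_def mem_Collect_eq
      by (rule le_less_trans)
    then show ?thesis unfolding dom_F [symmetric] by (simp only: ereal_dom_def mem_Collect_eq)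
  qed
  have opt: "y \<in> ereal_dom \<Psi>" "f y + real_of_ereal (\<Psi> y) = Fstar" if "y \<in> optimal_set F" for y
  proof -
    have "F y = ereal Fstar"
      unfolding Fstar_eq optimal_value_def
      using that by (intro antisym INF_greatest INF_lower) (auto simp: optimal_set_def)
    then show "y \<in> ereal_dom \<Psi>" unfolding dom_F [symmetric] by (simp add: ereal_dom_def)
    then show "f y + real_of_ereal (\<Psi> y) = Fstar" using \<open>F y = ereal Fstar\<close> F_eq_real by simp
  qed
  have e_eq: "e h = f (X h) + real_of_ereal (\<Psi> (X h)) - Fstar" for h
    using F_eq_real [OF in_dom [of h]] by (simp add: e_def)
  have e_nonneg: "0 \<le> e h" for h
  proof -
    have "ereal Fstar \<le> F (X h)" unfolding Fstar_eq optimal_value_def by (rule INF_lower) simp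
    then show ?thesis using F_eq_real [OF in_dom [of h]] by (simp add: e_eq)
  qed
  have r: "infdist (X h) (optimal_set F) \<le> r" and q: "norm (g (X h)) \<le> q" for h
    unfolding r_eq q_eq by (intro cSUP_upper in_level r_finite q_finite)+
  have "0 < c"
    using params by (simp add: c_eq)
  have "0 \<le> r" "0 \<le> q"
    using order_trans [OF infdist_nonneg r] order_trans [OF norm_ge_zero q] by auto
  then have "0 < K"
    using L\<Psi>_pos \<open>0 < c\<close> by (simp add: K_def add_pos_nonneg)
  have "0 < Min (range p)" using p_bounds by simp
  then have "0 < \<alpha>"
    using \<open>0 < K\<close> \<open>\<sigma> > 0\<close> unfolding \<alpha>_eq K_def
    by (intro divide_pos_pos mult_pos_pos zero_less_power) auto
  have decr: "(\<Sum>i\<in>UNIV. p i * e (h @ [i])) \<le> e h - \<alpha> * (e h)\<^sup>2" for h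
  proof -
    let ?x = "X h"
    have "\<exists>\<theta> s. 0 < \<theta> \<and> \<theta> \<le> c \<and> is_trial_step \<beta> g \<psi> \<theta> i ?x s \<and>
        sufficient_decrease F \<sigma> ?x s \<and> X (h @ [i]) = ?x + s" for i
    proof -
      have "rnbpg_step \<beta> f g \<psi> \<eta> \<sigma> \<theta>lo \<theta>hi i ?x (X (h @ [i]))"
        using run by (simp add: rnbpg_run_def)
      from rnbpg_step_accepted [OF this in_dom block_lipschitz params(1,3)]
      obtain \<theta> s where *: "0 < \<theta>" "\<theta> \<le> max \<theta>hi (\<eta> * (L i + \<sigma>))"
        "is_trial_step \<beta> g \<psi> \<theta> i ?x s" "sufficient_decrease F \<sigma> ?x s" "X (h @ [i]) = ?x + s"
        by blast
      have "max \<theta>hi (\<eta> * (L i + \<sigma>)) \<le> c"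
        unfolding c_eq using params(1) by (intro max.mono order_refl mult_left_mono) auto
      with * show ?thesis by (meson order_trans)
    qed
    \<comment> \<open>One accepted step for every possible draw, since \<open>X\<close> is defined on all histories.\<close>
    then obtain \<theta> s where \<theta>: "\<And>i. 0 < \<theta> i" "\<And>i. \<theta> i \<le> c"
      and trial: "\<And>i. is_trial_step \<beta> g \<psi> (\<theta> i) i ?x (s i)"
      and suff: "\<And>i. sufficient_decrease F \<sigma> ?x (s i)"
      and next_iterate: "\<And>i. X (h @ [i]) = ?x + s i"
      by metis
    define d where "d = (\<Sum>i\<in>UNIV. s i)"
    have dom_d: "?x + d \<in> ereal_dom \<Psi>"
      by (rule trial_steps_subgradient(1) [OF \<Psi>_convex trial in_dom in_dom d_def refl])
    have lip: "real_of_ereal (\<Psi> ?x) - real_of_ereal (\<Psi> (?x + d)) \<le> L\<Psi> * norm d"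
    proof -
      have "\<bar>ereal (real_of_ereal (\<Psi> ?x)) - ereal (real_of_ereal (\<Psi> (?x + d)))\<bar> \<le> ereal (L\<Psi> * norm (?x - (?x + d)))"
        using \<Psi>_lipschitz [OF in_dom dom_d, of h] by (simp only: \<Psi>_eq_real in_dom dom_d)
      then show ?thesis by simp
    qed
    have gap: "e h \<le> K * norm d"
      unfolding e_eq K_def
      by (rule optimality_gap_le_step_norm [OF f_convex \<Psi>_convex trial in_dom less_imp_le [OF \<theta>(1)] \<theta>(2) \<open>0 < c\<close> optimal_nonempty
            opt r q d_def lip])
    have norm_d: "(norm d)\<^sup>2 = (\<Sum>i\<in>UNIV. (norm (s i))\<^sup>2)"
    proof -
      have "block \<beta> i d = s i" for i
        unfolding d_def by (rule block_sum_block_space [OF trial_step_minimizes(1) [OF trial in_dom]])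
      then show ?thesis by (simp add: sum_norm_block [of \<beta> d, symmetric])
    qed
    have step: "e (h @ [i]) \<le> e h - \<sigma> / 2 * (norm (s i))\<^sup>2" for i
    proof -
      have "F (X (h @ [i])) \<le> F ?x - ereal (\<sigma> / 2 * (norm (s i))\<^sup>2)"
        using suff [of i] by (simp add: sufficient_decrease_def next_iterate)
      then show ?thesis
        using F_eq_real [OF in_dom [of h]] F_eq_real [OF in_dom [of "h @ [i]"]] by (simp add: e_eq)
    qed
    show ?thesis
      using expected_gap_decrease [OF p_bounds(1) p_sum \<open>\<sigma> > 0\<close> \<open>0 < K\<close> e_nonneg step norm_d gap]
      by (simp only: \<alpha>_eq K_def)
  qed
  have "(LINT \<omega>|M. real_of_ereal (F (X (map (\<lambda>j. I j \<omega>) [0..<k])))) - Fstar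
      = history_expectation p k (\<lambda>h. real_of_ereal (F (X h))) - 1 * Fstar"
    using expectation_history [OF indices_indep indices_distr, where G = "\<lambda>h. real_of_ereal (F (X h))"]
    by simp
  also have "\<dots> = history_expectation p k e"
    using history_expectation_diff [of p k "\<lambda>h. real_of_ereal (F (X h))" 1 "\<lambda>_. Fstar"]
    by (simp add: e_def [abs_def] history_expectation_const [OF p_sum])
  also have "\<dots> \<le> max (2 / \<alpha>) (e []) / (real k + 1)"
    by (rule history_expectation_rate [OF _ p_sum \<open>0 < \<alpha>\<close> e_nonneg decr])
      (use p_bounds less_imp_le in blast)
  also have "e [] = real_of_ereal (F x0) - Fstar"
    using run by (simp add: e_def rnbpg_run_def)
  finally show ?thesis .
qed

end
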